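(* For all sufficiently large $n\in\mathbb{N}$ the following holds. There exist unit vectors $a_1,\dots,a_n\in\mathbb{R}^n$ such that the choice of signs $\epsilon=(1,1,\dots,1)$ maximizes $\left\|\sum_{j=1}^n\epsilon_j a_j\right\|_2$ among all $\epsilon\in\{-1,1\}^n$ and the normalized mean vector $$x:=\frac{a_1+\cdots+a_n}{\|a_1+\cdots+a_n\|_2}$$ satisfies $$\prod_{j=1}^n|\langle x,a_j\rangle|<n^{-n/2}.$$ The analogous result holds in the complex case: there exist unit vectors $a_1,\dots,a_n\in\mathbb{C}^n$ such that $\epsilon=(1,1,\dots,1)$ maximizes $\left\|\sum_{j=1}^n\epsilon_j a_j\right\|_2$ among all complex signs $\epsilon=(e^{i\varphi_1},\dots,e^{i\varphi_n})$, $\varphi_j\in[0,2\pi)$, and the vector $x=(a_1+\cdots+a_n)/\|a_1+\cdots+a_n\|_2$ satisfies $\prod_{j=1}^n|\langle x,a_j\rangle|<n^{-n/2}$.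
   Context: $\mathbb{R}^n$ and $\mathbb{C}^n$ carry the standard inner product $\langle\cdot,\cdot\rangle$ and Euclidean norm $\|\cdot\|_2$. *)

theory Defs
  imports "HOL-Analysis.L2_Norm" "Jordan_Normal_Form.Matrix"
begin

definition l2norm :: "'a :: real_normed_vector Matrix.vec \<Rightarrow> real" where
  "l2norm v = L2_set (\<lambda>i. norm (vec_index v i)) {..<dim_vec v}"

definition signed_sum :: "nat \<Rightarrow> (nat \<Rightarrow> 'a) \<Rightarrow> (nat \<Rightarrow> 'a :: semiring_1 Matrix.vec) \<Rightarrow> 'a Matrix.vec" where
  "signed_sum n \<epsilon> a = finsum_vec TYPE('a) n (\<lambda>j. \<epsilon> j \<cdot>\<^sub>v a j) {1..n}"

text \<open>The definition below inherits \<open>inverse 0 = 0\<close>, so it yields the zero vector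
  when the sum of the \<open>a j\<close> is zero.\<close>

definition normalized_mean :: "nat \<Rightarrow> (nat \<Rightarrow> 'a :: real_normed_field Matrix.vec) \<Rightarrow> 'a Matrix.vec" where
  "normalized_mean n a =
     (let s = finsum_vec TYPE('a) n a {1..n} in of_real (inverse (l2norm s)) \<cdot>\<^sub>v s)"

lemma l2norm_real: "l2norm (v :: real Matrix.vec) = sqrt (v \<bullet>c v)"
  by (simp add: l2norm_def L2_set_def scalar_prod_def power2_eq_square lessThan_atLeast0)

lemma l2norm_complex: "complex_of_real ((l2norm v)\<^sup>2) = v \<bullet>c v"
proof -
  have "complex_of_real ((l2norm v)\<^sup>2) = (\<Sum>i<dim_vec v. complex_of_real ((norm (vec_index v i))\<^sup>2))"
    by (simp add: l2norm_def L2_set_def sum_nonneg)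
  also have "\<dots> = v \<bullet>c v"
    by (simp only: complex_norm_square scalar_prod_def dim_vec_conjugate lessThan_atLeast0)
       (rule sum.cong, auto)
  finally show ?thesis .
qed

end

theory Submission
  imports Defs "HOL-Analysis.Inner_Product" "HOL-Real_Asymp.Real_Asymp"
begin

text \<open>
  Take \<open>m \<approx> 2\<surd>n\<close> copies of one unit vector \<open>u\<close> together with \<open>N = n - m\<close> unit vectors whose
  components along \<open>u\<close> all equal \<open>\<alpha> = 1 / (2\<surd>n)\<close> and whose components orthogonal to \<open>u\<close> form a
  regular simplex centred at the origin. Then \<open>x = u\<close>, and the product is \<open>\<alpha> ^ N\<close>, which is below
  \<open>n powr (-n/2)\<close> because \<open>2 ^ N\<close> beats \<open>n powr (m/2)\<close>. If \<open>t\<close> is the sum of the signs of the simplex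
  vectors, the squared norm of the signed sum is at most a quadratic polynomial in \<open>\<bar>t\<bar>\<close>, which on
  \<open>[0, N]\<close> is largest at \<open>N\<close>, since \<open>\<alpha> m \<ge> 1\<close>. The argument is the same for real and complex signs.
\<close>

section \<open>Sums of squares and a quadratic bound\<close>

text \<open>The sum of squares splits into the spread about the mean, which the shift
  \<open>w\<close> leaves unchanged, and \<open>N\<close> times the squared norm of the
  mean.\<close>

lemma sum_norm_sq_shift:
  fixes e :: "nat \<Rightarrow> 'a::real_inner"
  assumes "N > 0"
  shows "(\<Sum>i<N. (norm (p *\<^sub>R e i + w))\<^sup>2) =
    p\<^sup>2 * ((\<Sum>i<N. (norm (e i))\<^sup>2) - (norm (\<Sum>i<N. e i))\<^sup>2 / N)
    + (norm (p *\<^sub>R (\<Sum>i<N. e i) + real N *\<^sub>R w))\<^sup>2 / N"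
proof -
  have expand: "(norm (p *\<^sub>R x + c *\<^sub>R w))\<^sup>2
      = p\<^sup>2 * (norm x)\<^sup>2 + 2 * p * c * inner x w + c\<^sup>2 * (norm w)\<^sup>2"
    for x c
    unfolding power2_norm_eq_inner
    by (simp add: inner_add_left inner_add_right inner_commute[of w x] algebra_simps power2_eq_square)
  have "(\<Sum>i<N. (norm (p *\<^sub>R e i + w))\<^sup>2)
      = p\<^sup>2 * (\<Sum>i<N. (norm (e i))\<^sup>2) + 2 * p * inner (\<Sum>i<N. e i) w + N * (norm w)\<^sup>2"
    unfolding expand[where c = 1, simplified] sum.distrib
    by (simp add: inner_sum_left flip: sum_distrib_left)
  then show ?thesis
    unfolding expand[of "\<Sum>i<N. e i" N]
    using assms by (simp add: add_divide_distrib right_diff_distrib power2_eq_square)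
qed

text \<open>The derivative of the left side in \<open>\<tau>\<close> is affine, nonnegative at
  \<open>0\<close> by \<open>0 \<le> \<alpha> * m\<close> and at \<open>N\<close> by
  \<open>slope\<close>. So the left side increases up to \<open>\<tau> = N\<close>, where both sides
  agree.\<close>

lemma quadratic_le_at_right_end:
  fixes \<alpha> m N p \<tau> :: real
  assumes "0 \<le> \<tau>" "\<tau> \<le> N" "0 < N" "0 \<le> \<alpha> * m" and slope: "p\<^sup>2 \<le> \<alpha> * (m + \<alpha> * N)"
  shows "(m + \<alpha> * \<tau>)\<^sup>2 + p\<^sup>2 * (N - \<tau>\<^sup>2 / N) \<le> (m + \<alpha> * N)\<^sup>2"
proof -
  have "p\<^sup>2 / N \<le> \<alpha> * (m + \<alpha> * N) / N"
    using slope \<open>0 < N\<close> by (intro divide_right_mono) auto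
  also have "\<dots> = \<alpha> * m / N + \<alpha>\<^sup>2"
    using \<open>0 < N\<close> by (simp add: field_simps power2_eq_square)
  finally have "p\<^sup>2 / N - \<alpha>\<^sup>2 \<le> \<alpha> * m / N"
    by simp
  then have "(N + \<tau>) * (p\<^sup>2 / N - \<alpha>\<^sup>2) \<le> (N + \<tau>) * (\<alpha> * m / N)"
    using assms by (intro mult_left_mono) auto
  also have "\<dots> \<le> (2 * N) * (\<alpha> * m / N)"
    using assms by (intro mult_right_mono) auto
  \<comment> \<open>Agreement at \<open>\<tau> = N\<close> puts the factor \<open>N - \<tau>\<close>
    into the difference of the two sides; the cofactor is nonnegative by the preceding
    bound.\<close>
  finally have "0 \<le> (N - \<tau>) * (2 * \<alpha> * m - (N + \<tau>) * (p\<^sup>2 / N - \<alpha>\<^sup>2))"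
    using assms by (intro mult_nonneg_nonneg) auto
  also have "\<dots> = (m + \<alpha> * N)\<^sup>2 - (m + \<alpha> * \<tau>)\<^sup>2 - p\<^sup>2 * (N - \<tau>\<^sup>2 / N)"
    using \<open>0 < N\<close> by (simp add: field_simps power2_eq_square)
  finally show ?thesis by simp
qed

section \<open>Signed sums of the configuration and their norms\<close>

lemma l2norm_signed_sum:
  assumes "\<And>j. j \<in> {1..n} \<Longrightarrow> a j \<in> carrier_vec n"
  shows "l2norm (signed_sum n \<epsilon> a) = L2_set (\<lambda>i. norm (\<Sum>j=1..n. \<epsilon> j * a j $ i)) {..<n}"
proof -
  have carrier: "(\<lambda>j. \<epsilon> j \<cdot>\<^sub>v a j) \<in> {1..n} \<rightarrow> carrier_vec n"
    using assms by auto
  have "dim_vec (signed_sum n \<epsilon> a) = n"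
    using finsum_vec_closed[OF carrier] by (simp add: signed_sum_def)
  moreover have "signed_sum n \<epsilon> a $ i = (\<Sum>j=1..n. \<epsilon> j * a j $ i)" if "i < n" for i
    using index_finsum_vec[OF _ that carrier] that carrier_vecD[OF assms]
    by (auto simp: signed_sum_def intro!: sum.cong)
  ultimately show ?thesis
    unfolding l2norm_def by (intro L2_set_cong) auto
qed

text \<open>The vector \<open>u\<close> of the construction is \<open>1/\<surd>N\<close> times the indicator of the first \<open>N\<close> coordinates.
  The component along \<open>u\<close> of each of the first \<open>N\<close> vectors is \<open>(p + N q)/\<surd>N\<close>, hence the recurring
  hypothesis \<open>p + N q = \<alpha> \<surd>N\<close>.\<close>

definition cluster_simplex :: "nat \<Rightarrow> nat \<Rightarrow> real \<Rightarrow> real \<Rightarrow> nat \<Rightarrow> 'a::real_normed_field Matrix.vec" where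
  "cluster_simplex n N p q j = Matrix.vec n (\<lambda>i. of_real
     (if N \<le> i then 0 else if N < j then 1 / sqrt N else (if Suc i = j then p else 0) + q))"

lemma cluster_simplex_carrier [simp]: "cluster_simplex n N p q j \<in> carrier_vec n"
  by (simp add: cluster_simplex_def)

text \<open>Each coordinate below \<open>N\<close> is a multiple of one sign plus a term independent
  of \<open>i\<close>, the shape that \<open>sum_norm_sq_shift\<close> takes. \<open>Suc i\<close>
  appears because vectors are numbered from 1 and coordinates from 0.\<close>

lemma signed_sum_cluster_simplex:
  fixes \<epsilon> :: "nat \<Rightarrow> 'a::real_normed_field"
  assumes "N \<le> n" "i < n"
  shows "(\<Sum>j=1..n. \<epsilon> j * cluster_simplex n N p q j $ i) =
    (if N \<le> i then 0 else
       p *\<^sub>R \<epsilon> (Suc i) + (q *\<^sub>R (\<Sum>k<N. \<epsilon> (Suc k)) + (1 / sqrt N) *\<^sub>R (\<Sum>j=Suc N..n. \<epsilon> j)))"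
proof (cases "N \<le> i")
  case False
  have split: "(\<Sum>j=1..n. \<epsilon> j * cluster_simplex n N p q j $ i)
      = (\<Sum>j=1..N. \<epsilon> j * cluster_simplex n N p q j $ i)
      + (\<Sum>j=Suc N..n. \<epsilon> j * cluster_simplex n N p q j $ i)"
    using \<open>N \<le> n\<close> sum.ub_add_nat[of 1 N _ "n - N"] by simp
  have "(\<Sum>j=1..N. \<epsilon> j * cluster_simplex n N p q j $ i)
      = (\<Sum>j=1..N. (if j = Suc i then p *\<^sub>R \<epsilon> j else 0) + q *\<^sub>R \<epsilon> j)"
    using False assms
    by (intro sum.cong) (auto simp: cluster_simplex_def scaleR_conv_of_real algebra_simps)
  also have "\<dots> = p *\<^sub>R \<epsilon> (Suc i) + q *\<^sub>R (\<Sum>j=1..N. \<epsilon> j)"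
    using False by (simp add: sum.distrib scaleR_sum_right)
  also have "(\<Sum>j=1..N. \<epsilon> j) = (\<Sum>k<N. \<epsilon> (Suc k))"
    by (simp add: sum.atLeast1_atMost_eq)
  finally have "(\<Sum>j=1..N. \<epsilon> j * cluster_simplex n N p q j $ i)
      = p *\<^sub>R \<epsilon> (Suc i) + q *\<^sub>R (\<Sum>k<N. \<epsilon> (Suc k))" .
  moreover
  have "(\<Sum>j=Suc N..n. \<epsilon> j * cluster_simplex n N p q j $ i)
      = (1 / sqrt N) *\<^sub>R (\<Sum>j=Suc N..n. \<epsilon> j)"
    using False assms
    by (auto simp: cluster_simplex_def scaleR_conv_of_real sum_distrib_left intro!: sum.cong)
  ultimately show ?thesis
    using False split by simp
qed (use assms in \<open>simp add: cluster_simplex_def\<close>)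

text \<open>Pythagoras relative to \<open>u\<close>: the first summand comes from the part
  orthogonal to \<open>u\<close>, the second from the component along \<open>u\<close>.\<close>

lemma l2norm_signed_sum_cluster_simplex:
  fixes \<epsilon> :: "nat \<Rightarrow> 'a::{real_normed_field, real_inner}"
  assumes "0 < N" "N \<le> n" and pq: "p + N * q = \<alpha> * sqrt N"
  shows "(l2norm (signed_sum n \<epsilon> (cluster_simplex n N p q)))\<^sup>2 =
    p\<^sup>2 * ((\<Sum>i<N. (norm (\<epsilon> (Suc i)))\<^sup>2) - (norm (\<Sum>i<N. \<epsilon> (Suc i)))\<^sup>2 / N)
    + (norm (\<alpha> *\<^sub>R (\<Sum>i<N. \<epsilon> (Suc i)) + (\<Sum>j=Suc N..n. \<epsilon> j)))\<^sup>2"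
proof -
  define t where "t = (\<Sum>i<N. \<epsilon> (Suc i))"
  define P where "P = (\<Sum>j=Suc N..n. \<epsilon> j)"
  define w where "w = q *\<^sub>R t + (1 / sqrt N) *\<^sub>R P"
  have "(l2norm (signed_sum n \<epsilon> (cluster_simplex n N p q)))\<^sup>2
      = (\<Sum>i<n. (norm (\<Sum>j=1..n. \<epsilon> j * cluster_simplex n N p q j $ i))\<^sup>2)"
    by (subst l2norm_signed_sum) (auto simp: L2_set_def sum_nonneg)
  also have "\<dots> = (\<Sum>i<n. if N \<le> i then 0 else (norm (p *\<^sub>R \<epsilon> (Suc i) + w))\<^sup>2)"
    using assms
    by (intro sum.cong) (simp_all only: signed_sum_cluster_simplex lessThan_iff w_def t_def P_def, auto)
  also have "\<dots> = (\<Sum>i<N. (norm (p *\<^sub>R \<epsilon> (Suc i) + w))\<^sup>2)"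
    using assms by (intro sum.mono_neutral_cong_right) auto
  also have "\<dots> = p\<^sup>2 * ((\<Sum>i<N. (norm (\<epsilon> (Suc i)))\<^sup>2) - (norm t)\<^sup>2 / N)
      + (norm (p *\<^sub>R t + real N *\<^sub>R w))\<^sup>2 / N"
    unfolding t_def by (rule sum_norm_sq_shift) fact
  also have "p *\<^sub>R t + real N *\<^sub>R w = (p + N * q) *\<^sub>R t + (N / sqrt N) *\<^sub>R P"
    by (simp add: w_def algebra_simps)
  \<comment> \<open>Both coefficients equal a multiple of \<open>sqrt N\<close>; the square of this
    common factor cancels the division by \<open>N\<close>.\<close>
  also have "\<dots> = sqrt N *\<^sub>R (\<alpha> *\<^sub>R t + P)"
    unfolding pq by (simp add: real_div_sqrt algebra_simps)
  also have "(norm \<dots>)\<^sup>2 / N = (norm (\<alpha> *\<^sub>R t + P))\<^sup>2"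
    using assms by (simp add: power_mult_distrib)
  finally show ?thesis
    by (simp add: t_def P_def)
qed

text \<open>The left side of \<open>unit\<close> is the squared norm of a vector with one entry
  \<open>p + q\<close> and \<open>N - 1\<close> entries \<open>q\<close>.\<close>

lemma l2norm_cluster_simplex:
  fixes p q :: real
  assumes "0 < N" "N \<le> n" "1 \<le> j" and unit: "p\<^sup>2 + 2 * p * q + N * q\<^sup>2 = 1"
  shows "l2norm (cluster_simplex n N p q j) = 1"
proof -
  have "(\<Sum>i<n. (norm (cluster_simplex n N p q j $ i))\<^sup>2)
     = (\<Sum>i<N. (if N < j then 1 / sqrt N else (if Suc i = j then p else 0) + q)\<^sup>2)"
    using assms by (intro sum.mono_neutral_cong_right) (auto simp: cluster_simplex_def)
  also have "\<dots> = 1"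
  proof (cases "N < j")
    case False
    have "(\<Sum>i<N. ((if Suc i = j then p else 0) + q)\<^sup>2)
        = (\<Sum>i<N. (if i = j - 1 then p\<^sup>2 + 2 * p * q else 0) + q\<^sup>2)"
      using \<open>1 \<le> j\<close> by (intro sum.cong) (auto simp: power2_eq_square algebra_simps)
    also have "\<dots> = p\<^sup>2 + 2 * p * q + N * q\<^sup>2"
      using False \<open>1 \<le> j\<close> by (simp add: sum.distrib)
    finally show ?thesis
      using False unit by simp
  qed (use assms in \<open>simp add: power_divide\<close>)
  finally show ?thesis
    by (simp add: l2norm_def L2_set_def cluster_simplex_def)
qed

lemma finsum_vec_eq_signed_sum:
  fixes a :: "nat \<Rightarrow> 'a::comm_semiring_1 Matrix.vec"
  shows "finsum_vec TYPE('a) n a {1..n} = signed_sum n (\<lambda>j. 1) a"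
  by (simp add: signed_sum_def)

text \<open>With all signs equal to 1 the spread is \<open>N - N^2 / N = 0\<close>, so the sum lies
  along \<open>u\<close>.\<close>

lemma l2norm_signed_sum_cluster_simplex_ones:
  assumes "0 < N" "N \<le> n" "0 \<le> \<alpha>" and pq: "p + N * q = \<alpha> * sqrt N"
  shows "l2norm (signed_sum n (\<lambda>j. 1 :: 'a::{real_normed_field, real_inner}) (cluster_simplex n N p q))
    = real (n - N) + \<alpha> * N"
proof -
  have "norm (\<alpha> *\<^sub>R of_nat N + of_nat (n - N) :: 'a) = norm (of_real (real (n - N) + \<alpha> * N) :: 'a)"
    by (simp add: scaleR_conv_of_real add.commute)
  also have "\<dots> = real (n - N) + \<alpha> * N"
    unfolding norm_of_real using assms by simp
  finally have "(l2norm (signed_sum n (\<lambda>j. 1 :: 'a) (cluster_simplex n N p q)))\<^sup>2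
      = (real (n - N) + \<alpha> * N)\<^sup>2"
    unfolding l2norm_signed_sum_cluster_simplex[OF assms(1,2) pq]
    using assms by (simp del: of_nat_diff add: power2_eq_square)
  then show ?thesis
    using assms by (simp add: l2norm_def)
qed

text \<open>The triangle inequality bounds the component along \<open>u\<close> by
  \<open>n - N + \<alpha> * norm t\<close>, which reduces the claim to
  \<open>quadratic_le_at_right_end\<close> at \<open>\<tau> = norm t\<close>.\<close>

lemma signed_sum_cluster_simplex_le_ones:
  fixes \<epsilon> :: "nat \<Rightarrow> 'a::{real_normed_field, real_inner}"
  assumes "0 < N" "N \<le> n" "0 \<le> \<alpha>" and pq: "p + N * q = \<alpha> * sqrt N"
    and slope: "p\<^sup>2 \<le> \<alpha> * (real (n - N) + \<alpha> * N)"
    and \<epsilon>: "\<And>j. j \<in> {1..n} \<Longrightarrow> norm (\<epsilon> j) = 1"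
  shows "l2norm (signed_sum n \<epsilon> (cluster_simplex n N p q))
    \<le> l2norm (signed_sum n (\<lambda>j. 1) (cluster_simplex n N p q :: nat \<Rightarrow> 'a Matrix.vec))"
proof -
  define t where "t = (\<Sum>i<N. \<epsilon> (Suc i))"
  define P where "P = (\<Sum>j=Suc N..n. \<epsilon> j)"
  have "norm t \<le> (\<Sum>i<N. 1)"
    unfolding t_def using assms by (intro sum_norm_le) auto
  then have t: "norm t \<le> N" by simp
  have "norm P \<le> (\<Sum>j=Suc N..n. 1)"
    unfolding P_def using assms by (intro sum_norm_le) auto
  then have P: "norm P \<le> real (n - N)" by simp
  have "norm (\<alpha> *\<^sub>R t + P) \<le> real (n - N) + \<alpha> * norm t"
    using norm_triangle_ineq[of "\<alpha> *\<^sub>R t" P] P \<open>0 \<le> \<alpha>\<close> by simp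
  then have *: "(norm (\<alpha> *\<^sub>R t + P))\<^sup>2 \<le> (real (n - N) + \<alpha> * norm t)\<^sup>2"
    by (intro power_mono) auto
  have "(\<Sum>i<N. (norm (\<epsilon> (Suc i)))\<^sup>2) = N"
    using assms by simp
  then have "(l2norm (signed_sum n \<epsilon> (cluster_simplex n N p q)))\<^sup>2
      = p\<^sup>2 * (N - (norm t)\<^sup>2 / N) + (norm (\<alpha> *\<^sub>R t + P))\<^sup>2"
    by (simp add: l2norm_signed_sum_cluster_simplex[OF assms(1,2) pq] t_def P_def)
  also have "\<dots> \<le> (real (n - N) + \<alpha> * N)\<^sup>2"
  proof -
    have "(real (n - N) + \<alpha> * norm t)\<^sup>2 + p\<^sup>2 * (N - (norm t)\<^sup>2 / N) \<le> (real (n - N) + \<alpha> * N)\<^sup>2"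
      by (rule quadratic_le_at_right_end) (use t slope assms(1,3) in auto)
    then show ?thesis
      using * by linarith
  qed
  finally have "l2norm (signed_sum n \<epsilon> (cluster_simplex n N p q)) \<le> real (n - N) + \<alpha> * N"
    by (rule power2_le_imp_le) (use assms in auto)
  then show ?thesis
    using assms by (simp add: l2norm_signed_sum_cluster_simplex_ones)
qed

section \<open>The normalized mean and the product\<close>

lemma normalized_mean_cluster_simplex:
  assumes "0 < N" "N \<le> n" "0 < \<alpha>" and pq: "p + N * q = \<alpha> * sqrt N"
  shows "normalized_mean n (cluster_simplex n N p q :: nat \<Rightarrow> 'a::{real_normed_field, real_inner} Matrix.vec)
    = Matrix.vec n (\<lambda>i. of_real (if N \<le> i then 0 else 1 / sqrt N))"
    (is "normalized_mean n ?a = _")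
proof -
  define T where "T = real (n - N) + \<alpha> * N"
  \<comment> \<open>The sum has norm \<open>T\<close>, so the default value
    \<open>inverse 0 = 0\<close> does not occur in the normalization.\<close>
  have "T > 0"
    using assms by (simp add: T_def add_nonneg_pos)
  have dim: "dim_vec (signed_sum n (\<lambda>j. 1) ?a) = n"
    unfolding signed_sum_def using finsum_vec_closed[of "\<lambda>j. 1 \<cdot>\<^sub>v ?a j" "{1..n}" n] by auto
  have "signed_sum n (\<lambda>j. 1) ?a $ i = of_real (if N \<le> i then 0 else T / sqrt N)" if "i < n" for i
  proof -
    have "signed_sum n (\<lambda>j. 1) ?a $ i = (\<Sum>j=1..n. 1 * ?a j $ i)"
      using index_finsum_vec[OF _ that, of "{1..n}" "\<lambda>j. 1 \<cdot>\<^sub>v ?a j"] that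
      by (auto simp: signed_sum_def)
    also have "\<dots> = of_real (if N \<le> i then 0 else p + N * q + (n - N) / sqrt N)"
      by (subst signed_sum_cluster_simplex[OF \<open>N \<le> n\<close> that]) (simp add: scaleR_conv_of_real)
    also have "p + N * q + (n - N) / sqrt N = T / sqrt N"
      using assms by (simp add: pq T_def add_divide_distrib real_div_sqrt flip: times_divide_eq_right)
    finally show ?thesis .
  qed
  with \<open>T > 0\<close> dim show ?thesis
    unfolding normalized_mean_def finsum_vec_eq_signed_sum Let_def
      l2norm_signed_sum_cluster_simplex_ones[OF assms(1,2) less_imp_le[OF assms(3)] pq]
      T_def[symmetric]
    by (intro eq_vecI) (auto simp flip: of_real_mult of_real_inverse)
qed

text \<open>The factors are \<open>\<alpha>\<close> for the simplex vectors and 1 for the copies of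
  \<open>u\<close>. All entries are embedded reals, so \<open>conj\<close> removes the conjugation
  over either field.\<close>

lemma prod_normalized_mean_cluster_simplex:
  assumes conj: "\<And>r. conjugate (of_real r :: 'a) = of_real r"
    and "0 < N" "N \<le> n" "0 < \<alpha>" and pq: "p + N * q = \<alpha> * sqrt N"
  defines "a \<equiv> cluster_simplex n N p q ::
    nat \<Rightarrow> 'a::{real_normed_field, real_inner, conjugatable_field} Matrix.vec"
  shows "(\<Prod>j=1..n. norm (normalized_mean n a \<bullet>c a j)) = \<alpha> ^ N"
proof -
  have "norm (normalized_mean n a \<bullet>c a j) = (if j \<le> N then \<alpha> else 1)" if j: "j \<in> {1..n}" for j
  proof -
    have "normalized_mean n a \<bullet>c a j = (\<Sum>i<n. of_real (if N \<le> i then 0 else 1 / sqrt N) *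
        of_real (if N \<le> i then 0 else if N < j then 1 / sqrt N else (if Suc i = j then p else 0) + q))"
      unfolding a_def normalized_mean_cluster_simplex[OF assms(2-4) pq]
      by (simp add: scalar_prod_def cluster_simplex_def conj lessThan_atLeast0)
    also have "\<dots> = of_real (\<Sum>i<n. (if N \<le> i then 0 else 1 / sqrt N) *
        (if N \<le> i then 0 else if N < j then 1 / sqrt N else (if Suc i = j then p else 0) + q))"
      by simp
    also have "(\<Sum>i<n. (if N \<le> i then 0 else 1 / sqrt N) *
        (if N \<le> i then 0 else if N < j then 1 / sqrt N else (if Suc i = j then p else 0) + q))
      = (\<Sum>i<N. 1 / sqrt N * (if N < j then 1 / sqrt N else (if i = j - 1 then p else 0) + q))"
      using assms j by (intro sum.mono_neutral_cong_right) auto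
    also have "\<dots> = (if j \<le> N then (p + N * q) / sqrt N else 1)"
      using assms j by (auto simp: sum.distrib simp flip: sum_divide_distrib)
    also have "\<dots> = (if j \<le> N then \<alpha> else 1)"
      using assms by (simp add: pq)
    finally show ?thesis
      using \<open>0 < \<alpha>\<close> by simp
  qed
  then have "(\<Prod>j=1..n. norm (normalized_mean n a \<bullet>c a j)) = (\<Prod>j=1..n. if j \<le> N then \<alpha> else 1)"
    by simp
  also have "\<dots> = (\<Prod>j=1..N. \<alpha>)"
    using \<open>N \<le> n\<close> by (intro prod.mono_neutral_cong_right) auto
  finally show ?thesis by simp
qed

section \<open>Choice of the sizes for large \<open>n\<close>\<close>

text \<open>With \<open>\<alpha> = 1 / (2 * sqrt n)\<close>, the second and third bounds say
  \<open>1 / (N - 1) \<le> \<alpha>^2 * N\<close> and \<open>1 \<le> \<alpha> * (n - N)\<close>;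
  together they yield the slope condition.\<close>

lemma eventually_cluster_size:
  "\<forall>\<^sub>F n in sequentially. \<exists>N\<le>n. 2 \<le> N \<and> 4 * n \<le> N * (N - 1) \<and> 2 * sqrt n \<le> real (n - N)
     \<and> (1 / (2 * sqrt n)) ^ N < real n powr (- (real n / 2))"
proof -
  have "\<forall>\<^sub>F n in sequentially. real n * ln 4 / 2 > (2 * sqrt n + 1) * ln n"
       "\<forall>\<^sub>F n in sequentially. 2 * sqrt n + 1 \<le> real n / 2"
    by real_asymp+
  then show ?thesis
    \<comment> \<open>18 is the least positive \<open>n\<close> with
      \<open>4 * n \<le> (n / 2) * (n / 2 - 1)\<close>.\<close>
    using eventually_ge_at_top[of 18]
  proof eventually_elim
    case (elim n)
    define m where "m = nat \<lceil>2 * sqrt n\<rceil>"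
    define N where "N = n - m"
    have m: "2 * sqrt n \<le> m" "m \<le> 2 * sqrt n + 1"
      unfolding m_def by (simp_all add: of_nat_ceiling)
    then have "m \<le> n"
      using elim by linarith
    then have m_eq: "n - N = m" and N_real: "real N = real n - real m"
      by (auto simp: N_def)
    have N: "real n / 2 \<le> N"
      using N_real m elim by linarith
    have "4 * real n \<le> (real n / 2) * (real n / 2 - 1)"
      using elim by (simp add: field_simps)
    also have "\<dots> \<le> N * (real N - 1)"
      using N elim by (intro mult_mono) auto
    also have "\<dots> = real (N * (N - 1))"
      using N elim by (simp add: of_nat_diff)
    finally have "4 * n \<le> N * (N - 1)"
      by linarith
    moreover have "(1 / (2 * sqrt n)) ^ N < real n powr (- (real n / 2))"
    proof -
      \<comment> \<open>In logarithms, with \<open>N = n - m\<close>, the claim becomes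
        \<open>m * ln n < N * ln 4\<close>.\<close>
      have "real m * ln n \<le> (2 * sqrt n + 1) * ln n"
        using m elim by (intro mult_right_mono) auto
      also have "\<dots> < (real n / 2) * ln 4"
        using elim by simp
      also have "\<dots> \<le> N * ln 4"
        using N by (intro mult_right_mono) auto
      finally have "N * ln (1 / (2 * sqrt n)) < - (real n / 2) * ln n"
        using elim ln_realpow[of 2 2] by (simp add: N_real ln_div ln_mult ln_sqrt field_simps)
      then have "exp (N * ln (1 / (2 * sqrt n))) < exp (- (real n / 2) * ln n)"
        by simp
      then show ?thesis
        using elim by (simp add: powr_def exp_of_nat_mult)
    qed
    ultimately show ?case
      using m m_eq N elim by (intro exI[of _ N]) (auto simp: N_def)
  qed
qed

section \<open>Existence over a general field, then the real and complex cases\<close>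

lemma eventually_small_product:
  assumes conj: "\<And>r. conjugate (of_real r :: 'a::{real_normed_field, real_inner, conjugatable_field}) = of_real r"
  shows "\<forall>\<^sub>F n in sequentially. \<exists>a :: nat \<Rightarrow> 'a Matrix.vec.
            (\<forall>j\<in>{1..n}. a j \<in> carrier_vec n \<and> l2norm (a j) = 1) \<and>
            (\<forall>\<epsilon>. (\<forall>j\<in>{1..n}. norm (\<epsilon> j) = 1) \<longrightarrow>
                l2norm (signed_sum n \<epsilon> a) \<le> l2norm (signed_sum n (\<lambda>j. 1) a)) \<and>
            (\<Prod>j\<in>{1..n}. norm (normalized_mean n a \<bullet>c a j)) < real n powr (- (real n / 2))"
  using eventually_cluster_size eventually_gt_at_top[of 0]
proof eventually_elim
  case (elim n)
  then obtain N where N: "N \<le> n" "2 \<le> N" "4 * n \<le> N * (N - 1)" "2 * sqrt n \<le> real (n - N)"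
    and small: "(1 / (2 * sqrt n)) ^ N < real n powr (- (real n / 2))"
    by blast
  define \<alpha> where "\<alpha> = 1 / (2 * sqrt n)"
  \<comment> \<open>A simplex vector has an orthogonal part of squared norm
    \<open>p^2 * (1 - 1 / N)\<close>, which must equal \<open>1 - \<alpha>^2\<close>;
    \<open>q\<close> then makes its component along \<open>u\<close> equal to
    \<open>\<alpha>\<close>.\<close>
  define p where "p = sqrt (N * (1 - \<alpha>\<^sup>2) / (N - 1))"
  define q where "q = (\<alpha> * sqrt N - p) / N"
  have \<alpha>: "0 < \<alpha>" "\<alpha>\<^sup>2 = 1 / (4 * n)" "1 \<le> \<alpha> * real (n - N)"
    using elim N by (auto simp: \<alpha>_def power_divide field_simps)
  have "\<alpha>\<^sup>2 \<le> 1"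
    using elim by (simp add: \<alpha>(2))
  then have p2: "p\<^sup>2 = N * (1 - \<alpha>\<^sup>2) / (N - 1)"
    using N by (simp add: p_def)
  have pq: "p + N * q = \<alpha> * sqrt N"
    using N by (simp add: q_def)
  have "p\<^sup>2 + 2 * p * q + N * q\<^sup>2 = p\<^sup>2 * (1 - 1 / N) + (p + N * q)\<^sup>2 / N"
    using N by (simp add: field_simps power2_eq_square)
  also have "p\<^sup>2 * (1 - 1 / N) = 1 - \<alpha>\<^sup>2"
    using N by (simp add: p2 of_nat_diff field_simps)
  finally have unit: "p\<^sup>2 + 2 * p * q + N * q\<^sup>2 = 1"
    using N by (simp add: pq power_mult_distrib)
  \<comment> \<open>In the bound \<open>1 + 1 / (N - 1)\<close> for the square of \<open>p\<close>,
    the 1 is absorbed by \<open>\<alpha> * (n - N)\<close> and the fraction by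
    \<open>\<alpha>^2 * N\<close>.\<close>
  have "p\<^sup>2 \<le> N / (N - 1)"
    using N by (simp add: p2 divide_right_mono mult_left_le)
  also have "\<dots> = 1 + 1 / (N - 1)"
    using N by (simp add: of_nat_diff field_simps)
  also have "1 / (N - 1) \<le> \<alpha>\<^sup>2 * N"
  proof -
    have "real (4 * n) \<le> real (N * (N - 1))"
      using N(3) by (rule of_nat_mono)
    then show ?thesis
      using N elim by (simp add: \<alpha>(2) of_nat_diff field_simps)
  qed
  finally have slope: "p\<^sup>2 \<le> \<alpha> * (real (n - N) + \<alpha> * N)"
    using \<alpha>(3) by (simp add: distrib_left power2_eq_square mult.assoc del: of_nat_diff)
  have "0 < N"
    using N by simp
  show ?case
    by (intro exI[of _ "cluster_simplex n N p q"] conjI ballI allI impI cluster_simplex_carrier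
        l2norm_cluster_simplex[OF \<open>0 < N\<close> N(1) _ unit]
        signed_sum_cluster_simplex_le_ones[OF \<open>0 < N\<close> N(1) less_imp_le[OF \<alpha>(1)] pq slope])
      (use small in \<open>simp_all only: prod_normalized_mean_cluster_simplex[OF conj \<open>0 < N\<close> N(1) \<alpha>(1) pq]
          \<alpha>_def atLeastAtMost_iff\<close>)
qed

theorem theorem3:
  shows "(\<forall>\<^sub>F n in sequentially. \<exists>a :: nat \<Rightarrow> real Matrix.vec.
            (\<forall>j\<in>{1..n}. a j \<in> carrier_vec n \<and> l2norm (a j) = 1) \<and>
            (\<forall>\<epsilon> :: nat \<Rightarrow> real. (\<forall>j\<in>{1..n}. \<epsilon> j \<in> {-1, 1}) \<longrightarrow>
                l2norm (signed_sum n \<epsilon> a) \<le> l2norm (signed_sum n (\<lambda>j. 1) a)) \<and>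
            (\<Prod>j\<in>{1..n}. \<bar>normalized_mean n a \<bullet>c a j\<bar>) < real n powr (- (real n / 2)))
       \<and> (\<forall>\<^sub>F n in sequentially. \<exists>a :: nat \<Rightarrow> complex Matrix.vec.
            (\<forall>j\<in>{1..n}. a j \<in> carrier_vec n \<and> l2norm (a j) = 1) \<and>
            (\<forall>\<phi> :: nat \<Rightarrow> real. (\<forall>j\<in>{1..n}. \<phi> j \<in> {0..<2 * pi}) \<longrightarrow>
                l2norm (signed_sum n (\<lambda>j. exp (\<i> * complex_of_real (\<phi> j))) a)
                  \<le> l2norm (signed_sum n (\<lambda>j. 1) a)) \<and>
            (\<Prod>j\<in>{1..n}. cmod (normalized_mean n a \<bullet>c a j)) < real n powr (- (real n / 2)))"
proof
  have conj_real: "conjugate (of_real r :: real) = of_real r" for r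
    by simp
  show "\<forall>\<^sub>F n in sequentially. \<exists>a :: nat \<Rightarrow> real Matrix.vec.
            (\<forall>j\<in>{1..n}. a j \<in> carrier_vec n \<and> l2norm (a j) = 1) \<and>
            (\<forall>\<epsilon> :: nat \<Rightarrow> real. (\<forall>j\<in>{1..n}. \<epsilon> j \<in> {-1, 1}) \<longrightarrow>
                l2norm (signed_sum n \<epsilon> a) \<le> l2norm (signed_sum n (\<lambda>j. 1) a)) \<and>
            (\<Prod>j\<in>{1..n}. \<bar>normalized_mean n a \<bullet>c a j\<bar>) < real n powr (- (real n / 2))"
    using eventually_small_product[where ?'a = real, OF conj_real, unfolded real_norm_def]
  proof (rule eventually_mono, elim ex_forward conj_forward)
    fix n :: nat and a :: "nat \<Rightarrow> real Matrix.vec"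
    assume max: "\<forall>\<epsilon>. (\<forall>j\<in>{1..n}. \<bar>\<epsilon> j\<bar> = 1) \<longrightarrow>
      l2norm (signed_sum n \<epsilon> a) \<le> l2norm (signed_sum n (\<lambda>j. 1) a)"
    show "\<forall>\<epsilon> :: nat \<Rightarrow> real. (\<forall>j\<in>{1..n}. \<epsilon> j \<in> {-1, 1}) \<longrightarrow>
      l2norm (signed_sum n \<epsilon> a) \<le> l2norm (signed_sum n (\<lambda>j. 1) a)"
      \<comment> \<open>Both elements of \<open>{-1, 1}\<close> have absolute value 1.\<close>
      by (intro allI impI max[rule_format]) force
  qed
next
  have conj_complex: "conjugate (complex_of_real r) = of_real r" for r
    by (simp add: conjugate_complex_def)
  show "\<forall>\<^sub>F n in sequentially. \<exists>a :: nat \<Rightarrow> complex Matrix.vec.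
            (\<forall>j\<in>{1..n}. a j \<in> carrier_vec n \<and> l2norm (a j) = 1) \<and>
            (\<forall>\<phi> :: nat \<Rightarrow> real. (\<forall>j\<in>{1..n}. \<phi> j \<in> {0..<2 * pi}) \<longrightarrow>
                l2norm (signed_sum n (\<lambda>j. exp (\<i> * complex_of_real (\<phi> j))) a)
                  \<le> l2norm (signed_sum n (\<lambda>j. 1) a)) \<and>
            (\<Prod>j\<in>{1..n}. cmod (normalized_mean n a \<bullet>c a j)) < real n powr (- (real n / 2))"
    using eventually_small_product[where ?'a = complex, OF conj_complex]
  proof (rule eventually_mono, elim ex_forward conj_forward)
    fix n :: nat and a :: "nat \<Rightarrow> complex Matrix.vec"
    assume max: "\<forall>\<epsilon>. (\<forall>j\<in>{1..n}. cmod (\<epsilon> j) = 1) \<longrightarrow>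
      l2norm (signed_sum n \<epsilon> a) \<le> l2norm (signed_sum n (\<lambda>j. 1) a)"
    show "\<forall>\<phi> :: nat \<Rightarrow> real. (\<forall>j\<in>{1..n}. \<phi> j \<in> {0..<2 * pi}) \<longrightarrow>
      l2norm (signed_sum n (\<lambda>j. exp (\<i> * complex_of_real (\<phi> j))) a)
        \<le> l2norm (signed_sum n (\<lambda>j. 1) a)"
      \<comment> \<open>Each sign is \<open>cis (\<phi> j)\<close>, of modulus 1.\<close>
      by (intro allI impI max[rule_format]) (simp flip: cis_conv_exp)
  qed
qed

end
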